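(* Let $d\ge46$. Let $h_1<\dots<h_k$ and $h'_1<\dots<h'_{k'}$ be finite strictly increasing sequences of positive integers such that $h_1\ge7$, $h'_1\ge7$, $h_k=d+k+1$, $h'_{k'}=d+k'+1$, and $h_{i+1}-h_i\ge4$, $h'_{i+1}-h'_i\ge4$ for all relevant $i$. Then the lattices $L_d(h_1,\dots,h_k)$ and $L_d(h'_1,\dots,h'_{k'})$ are isometric if and only if $k=k'$ and $h_i=h'_i$ for all $i$.
   Context: For a strictly increasing (finite or infinite, possibly empty) sequence of positive integers $h_1<h_2<\dots$ (called holes) and an integer $d\ge1$, let $s_1<s_2<\dots<s_{d+2}$ be the $d+2$ smallest elements of $\{1,2,3,\dots\}\setminus\{h_1,h_2,\dots\}$, and define $L_d(h_1,h_2,\dots)=\{x\in\mathbb Z^{d+2}:\ \sum_{i=1}^{d+2}x_i=0,\ \sum_{i=1}^{d+2}s_ix_i=0\}$ with the standard inner product of $\mathbb R^{d+2}$; it is an even integral lattice of rank $d$. Isomorphism of lattices means isometry. *)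

theory Defs
  imports Main "HOL-Library.Infinite_Set"
begin

(* Vectors of Z^(d+2) are functions nat => int vanishing outside {0..<d+2};
   coordinate i (0-indexed) corresponds to s_(i+1). *)

definition nonhole :: "nat list \<Rightarrow> nat \<Rightarrow> nat" where
  "nonhole hs i = enumerate ({n. 1 \<le> n} - set hs) i"

definition Ld :: "nat \<Rightarrow> nat list \<Rightarrow> (nat \<Rightarrow> int) set" where
  "Ld d hs = {x. (\<forall>i\<ge>d+2. x i = 0) \<and> (\<Sum>i<d+2. x i) = 0 \<and>
                  (\<Sum>i<d+2. int (nonhole hs i) * x i) = 0}"

definition std_inner :: "nat \<Rightarrow> (nat \<Rightarrow> int) \<Rightarrow> (nat \<Rightarrow> int) \<Rightarrow> int" where
  "std_inner n x y = (\<Sum>i<n. x i * y i)"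

definition lattice_isometric :: "nat \<Rightarrow> (nat \<Rightarrow> int) set \<Rightarrow> (nat \<Rightarrow> int) set \<Rightarrow> bool" where
  "lattice_isometric n L L' \<longleftrightarrow> (\<exists>f. bij_betw f L L' \<and>
     (\<forall>x\<in>L. \<forall>y\<in>L. f (\<lambda>i. x i + y i) = (\<lambda>i. f x i + f y i)) \<and>
     (\<forall>x\<in>L. \<forall>y\<in>L. std_inner n (f x) (f y) = std_inner n x y))"

end

theory Submission
  imports Defs "HOL-Library.FuncSet"
begin

text \<open>Write \<open>e i\<close> for the unit vectors, indexed from 0, and \<open>\<beta> j = e (j + 1) - e j\<close>. The lattice
  is the kernel of \<open>x \<mapsto> \<Sum> s i * x i\<close> on the root lattice of type A, and its norm 4 vectors are the
  \<open>e a + e b - e c - e d\<close> with \<open>s a + s b = s c + s d\<close>. There are 15 disjoint pairs of neighbours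
  with difference 1, giving vectors \<open>\<beta> 0 - \<alpha> m\<close> of norm 4 and mutual inner product 2. Their images
  under an isometry \<open>f\<close> have signed supports of size 4 meeting pairwise in two points, hence form
  a sunflower, whose kernel \<open>u\<close> serves as the image of \<open>\<beta> 0\<close>: \<open>\<beta> j \<mapsto> f (\<beta> j - c j \<beta> 0) + c j u\<close>, with
  \<open>c j = s (j + 1) - s j\<close>, extends \<open>f\<close> to the root lattice. Such an extension is induced, up to a
  global sign, by a permutation of the coordinates, so the coefficients of the two lattices are
  affinely related; the position of the last hole rules out a reflection.\<close>

section \<open>The lattice as the kernel of a linear form, and bilinearity of the inner
  product\<close>

definition lat :: "nat \<Rightarrow> (nat \<Rightarrow> nat) \<Rightarrow> (nat \<Rightarrow> int) set" where
  "lat n s = {x. (\<forall>i\<ge>n. x i = 0) \<and> (\<Sum>i<n. x i) = 0 \<and> (\<Sum>i<n. int (s i) * x i) = 0}"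

lemma Ld_eq_lat: "Ld d hs = lat (d + 2) (nonhole hs)"
  by (simp add: Ld_def lat_def)

lemma std_inner_commute: "std_inner n x y = std_inner n y x"
  by (simp add: std_inner_def mult.commute)

lemma std_inner_add_left:
  "std_inner n (\<lambda>i. x i + y i) z = std_inner n x z + std_inner n y z"
  by (simp add: std_inner_def distrib_right sum.distrib)

lemma std_inner_add_right:
  "std_inner n z (\<lambda>i. x i + y i) = std_inner n z x + std_inner n z y"
  by (simp add: std_inner_def distrib_left sum.distrib)

lemma std_inner_scale_left: "std_inner n (\<lambda>i. c * x i) z = c * std_inner n x z"
  by (simp add: std_inner_def sum_distrib_left mult.assoc)

lemma std_inner_scale_right: "std_inner n z (\<lambda>i. c * x i) = c * std_inner n z x"
  by (simp add: std_inner_def sum_distrib_left mult.left_commute)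

lemma std_inner_diff_left:
  "std_inner n (\<lambda>i. x i - y i) z = std_inner n x z - std_inner n y z"
  by (simp add: std_inner_def left_diff_distrib sum_subtractf)

lemma std_inner_diff_right:
  "std_inner n z (\<lambda>i. x i - y i) = std_inner n z x - std_inner n z y"
  by (simp add: std_inner_def right_diff_distrib sum_subtractf)

lemmas std_inner_simps = std_inner_add_left std_inner_add_right std_inner_scale_left
  std_inner_scale_right std_inner_diff_left std_inner_diff_right

lemma square_le_std_inner: "i < n \<Longrightarrow> x i * x i \<le> std_inner n x x"
  unfolding std_inner_def by (rule member_le_sum) auto

subsection \<open>Short vectors with coordinate sum zero\<close>

definition flat :: "nat \<Rightarrow> (nat \<Rightarrow> int) \<Rightarrow> bool" where
  "flat n x \<longleftrightarrow> (\<forall>i<n. \<bar>x i\<bar> \<le> 1)"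

text \<open>Values are stored along with positions, so an intersection of two such sets keeps only
  the positions where both vectors are nonzero and agree. This turns inner products into
  intersection sizes.\<close>

definition signed_support :: "nat \<Rightarrow> (nat \<Rightarrow> int) \<Rightarrow> (nat \<times> int) set" where
  "signed_support n x = (\<lambda>i. (i, x i)) ` {i. i < n \<and> x i \<noteq> 0}"

lemma mem_signed_support: "(i, c) \<in> signed_support n x \<longleftrightarrow> i < n \<and> x i = c \<and> c \<noteq> 0"
  by (auto simp: signed_support_def)

lemma abs_le_oneD: "\<bar>x\<bar> \<le> 1 \<Longrightarrow> x = -1 \<or> x = 0 \<or> x = (1::int)"
  by auto

text \<open>Flatness of the difference rules out opposite signs at a common position, so every
  product \<open>x i * y i\<close> is 0 or 1.\<close>

lemma std_inner_flat:
  assumes "flat n x" "flat n y" "flat n (\<lambda>i. x i - y i)"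
  shows "std_inner n x y = int (card (signed_support n x \<inter> signed_support n y))"
proof -
  have *: "signed_support n x \<inter> signed_support n y
      = (\<lambda>i. (i, x i)) ` {i \<in> {..<n}. x i \<noteq> 0 \<and> x i = y i}"
    by (auto simp: signed_support_def)
  have "std_inner n x y = (\<Sum>i<n. if x i \<noteq> 0 \<and> x i = y i then 1 else 0)"
    unfolding std_inner_def
  proof (rule sum.cong)
    fix i assume "i \<in> {..<n}"
    with assms have "\<bar>x i\<bar> \<le> 1" "\<bar>y i\<bar> \<le> 1" "\<bar>x i - y i\<bar> \<le> 1" by (auto simp: flat_def)
    then show "x i * y i = (if x i \<noteq> 0 \<and> x i = y i then 1 else 0)"
      by (auto dest!: abs_le_oneD)
  qed simp
  also have "\<dots> = int (card {i \<in> {..<n}. x i \<noteq> 0 \<and> x i = y i})"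
    by (simp add: sum.If_cases Int_def)
  also have "\<dots> = int (card (signed_support n x \<inter> signed_support n y))"
    unfolding * by (subst card_image) (auto intro: inj_onI)
  finally show ?thesis .
qed

lemma std_inner_flat_self:
  "flat n x \<Longrightarrow> std_inner n x x = int (card (signed_support n x))"
  using std_inner_flat[of n x x] by (simp add: flat_def)

lemma card_support:
  "card {i. i < n \<and> x i \<noteq> 0} = card (signed_support n x)"
  unfolding signed_support_def by (subst card_image) (auto intro: inj_onI)

lemma flat_norm_two: "std_inner n x x = 2 \<Longrightarrow> flat n x"
  unfolding flat_def
proof (intro allI impI)
  fix i assume "std_inner n x x = 2" "i < n"
  then have "x i * x i \<le> 2" using square_le_std_inner[of i n x] by simp
  then have "\<bar>x i\<bar> * \<bar>x i\<bar> < 2 * 2" by (simp add: abs_mult_self_eq)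
  then show "\<bar>x i\<bar> \<le> 1"
    using mult_mono[of 2 "\<bar>x i\<bar>" 2 "\<bar>x i\<bar>"] by linarith
qed

text \<open>An entry of absolute value at least 2 would use up the whole norm; all other entries
  would vanish and the coordinate sum could not be zero.\<close>

lemma flat_norm_four:
  assumes "std_inner n x x = 4" "(\<Sum>i<n. x i) = 0"
  shows "flat n x"
  unfolding flat_def
proof (intro allI impI, rule ccontr)
  fix i assume i: "i < n" and "\<not> \<bar>x i\<bar> \<le> 1"
  then have "2 * 2 \<le> \<bar>x i\<bar> * \<bar>x i\<bar>" by (intro mult_mono) auto
  then have ge: "4 \<le> x i * x i" by (simp add: abs_mult_self_eq)
  have "std_inner n x x = x i * x i + (\<Sum>j\<in>{..<n} - {i}. x j * x j)"
    unfolding std_inner_def using i by (simp add: sum.remove)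
  moreover have nn: "(\<Sum>j\<in>{..<n} - {i}. x j * x j) \<ge> 0" by (rule sum_nonneg) simp
  ultimately have "(\<Sum>j\<in>{..<n} - {i}. x j * x j) = 0" using ge assms by linarith
  then have "\<forall>j\<in>{..<n} - {i}. x j * x j = 0"
    by (subst (asm) sum_nonneg_eq_0_iff) auto
  then have "(\<Sum>j\<in>{..<n} - {i}. x j) = 0" by (intro sum.neutral) auto
  then have "x i = 0" using assms(2) i by (simp add: sum.remove)
  with ge show False by simp
qed

definition dif :: "nat \<Rightarrow> nat \<Rightarrow> nat \<Rightarrow> int" where
  "dif a b = (\<lambda>k. of_bool (k = a) - of_bool (k = b))"

lemma sum_mult_dif:
  assumes "a < n" "b < n"
  shows "(\<Sum>i<n. g i * dif a b i) = g a - (g b :: int)"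
proof -
  have "(\<Sum>i<n. g i * of_bool (i = c)) = g c" if "c < n" for c
    using that by (simp add: of_bool_def if_distrib sum.delta' cong: if_cong)
  then show ?thesis using assms by (simp add: dif_def right_diff_distrib sum_subtractf)
qed

lemma sum_dif: "a < n \<Longrightarrow> b < n \<Longrightarrow> (\<Sum>i<n. dif a b i) = 0"
  using sum_mult_dif[of a n b "\<lambda>_. 1"] by simp

lemma std_inner_dif: "a < n \<Longrightarrow> b < n \<Longrightarrow> std_inner n x (dif a b) = x a - x b"
  by (simp add: std_inner_def sum_mult_dif)

text \<open>Flatness leaves two entries, each 1 or -1, and the zero sum makes them opposite.\<close>

lemma norm_two_eq_dif:
  assumes "std_inner n x x = 2" "(\<Sum>i<n. x i) = 0" "\<forall>i\<ge>n. x i = 0"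
  shows "\<exists>a b. a < n \<and> b < n \<and> a \<noteq> b \<and> x = dif a b"
proof -
  note fl = flat_norm_two[OF assms(1)]
  have "card {i. i < n \<and> x i \<noteq> 0} = 2"
    using std_inner_flat_self[OF fl] assms(1) card_support[of n x] by simp
  then obtain a b where ab: "{i. i < n \<and> x i \<noteq> 0} = {a, b}" "a \<noteq> b"
    by (auto simp: card_2_iff)
  then have lt: "a < n" "b < n" and nz: "x a \<noteq> 0" "x b \<noteq> 0" by blast+
  have z: "x i = 0" if "i \<noteq> a" "i \<noteq> b" for i
    using ab that assms(3) by (metis (mono_tags, lifting) insertE linorder_not_less mem_Collect_eq singletonD)
  have "(\<Sum>i<n. x i) = (\<Sum>i\<in>{a, b}. x i)"
    by (rule sum.mono_neutral_right) (use lt z in auto)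
  then have s: "x a + x b = 0" using assms(2) ab by simp
  have "\<bar>x a\<bar> \<le> 1" using fl lt by (simp add: flat_def)
  then consider "x a = 1" "x b = -1" | "x a = -1" "x b = 1" using nz s by linarith
  then show ?thesis
  proof cases
    case 1
    then have "x = dif a b" using z ab(2) by (auto simp: dif_def fun_eq_iff)
    then show ?thesis using lt ab(2) by blast
  next
    case 2
    then have "x = dif b a" using z ab(2) by (auto simp: dif_def fun_eq_iff)
    then show ?thesis using lt ab(2) by blast
  qed
qed

subsection \<open>Large families of 4-sets meeting pairwise in two points\<close>

text \<open>The traces on a fixed member \<open>W p\<close> are among the six 2-subsets of a 4-set,
  so three of the 13 or more other members share a trace \<open>K\<close>. With \<open>W p\<close>
  this gives four members with disjoint petals outside \<open>K\<close>, too many to be met by a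
  4-set that does not contain \<open>K\<close>.\<close>

lemma sunflower_four_two:
  fixes W :: "'i \<Rightarrow> 'a set"
  assumes fin: "finite M" and M: "card M \<ge> 14"
    and c4: "\<And>m. m \<in> M \<Longrightarrow> card (W m) = 4"
    and c2: "\<And>m m'. m \<in> M \<Longrightarrow> m' \<in> M \<Longrightarrow> m \<noteq> m' \<Longrightarrow> card (W m \<inter> W m') = 2"
  obtains K where "card K = 2" "\<And>m. m \<in> M \<Longrightarrow> K \<subseteq> W m"
    "\<And>m m'. m \<in> M \<Longrightarrow> m' \<in> M \<Longrightarrow> m \<noteq> m' \<Longrightarrow> W m \<inter> W m' = K"
proof -
  have finW: "finite (W m)" if "m \<in> M" for m
    using c4[OF that] card.infinite by fastforce
  obtain p where p: "p \<in> M" using M by fastforce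
  let ?T = "{K. K \<subseteq> W p \<and> card K = 2}"
  have cT: "card ?T = 6" using n_subsets[OF finW[OF p], of 2] c4[OF p] by (simp add: choose_two)
  have finT: "finite ?T" using finW[OF p] by simp
  have "\<exists>K\<in>?T. card (M - {p}) \<le> card ((\<lambda>m. W m \<inter> W p) -` {K} \<inter> (M - {p})) * card ?T"
  proof (rule pigeonhole_card)
    show "(\<lambda>m. W m \<inter> W p) \<in> (M - {p}) \<rightarrow> ?T" using c2 p by simp
    show "?T \<noteq> {}" using cT by fastforce
  qed (use fin finT in simp_all)
  then obtain K where K: "K \<subseteq> W p" "card K = 2"
    and "card (M - {p}) \<le> card ((\<lambda>m. W m \<inter> W p) -` {K} \<inter> (M - {p})) * 6"
    unfolding cT by blast
  then have "card ((\<lambda>m. W m \<inter> W p) -` {K} \<inter> (M - {p})) \<ge> 3" using M p fin by simp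
  then obtain Q where Q: "Q \<subseteq> (\<lambda>m. W m \<inter> W p) -` {K} \<inter> (M - {p})" "card Q = 3"
    using obtain_subset_with_card_n by metis
  let ?Q = "insert p Q"
  have finK: "finite K" using K(2) card.infinite by fastforce
  have finQ: "finite Q" using Q(2) card.infinite by fastforce
  have QM: "?Q \<subseteq> M" using Q p by auto
  have cQ: "card ?Q = 4" using Q finQ by (subst card_insert_disjoint) auto
  have KQ: "K \<subseteq> W q" if "q \<in> ?Q" for q using that Q(1) K by auto
  have inter: "W m \<inter> W m' = K"
    if "m \<in> M" "m' \<in> M" "m \<noteq> m'" "K \<subseteq> W m" "K \<subseteq> W m'" for m m'
  proof -
    have "K = W m \<inter> W m'" by (rule card_subset_eq) (use that c2 K(2) finW in auto)
    then show ?thesis by simp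
  qed
  have KM: "K \<subseteq> W m" if m: "m \<in> M" for m
  proof (rule ccontr)
    assume nK: "\<not> K \<subseteq> W m"
    then have mQ: "m \<notin> ?Q" using KQ by blast
    have lt: "card (W m \<inter> K) < 2" using nK psubset_card_mono[OF finK, of "W m \<inter> K"] K(2) by auto
    \<comment> \<open>With \<open>t < 2\<close> points of \<open>W m\<close> in \<open>K\<close>,
      each of the four disjoint petals takes \<open>2 - t\<close> more. The total
      \<open>4 * (2 - t) + t\<close> is at least 5, while \<open>W m\<close> has 4 points.\<close>
    have pet: "card (W m \<inter> (W q - K)) = 2 - card (W m \<inter> K)" if q: "q \<in> ?Q" for q
    proof -
      have "W m \<inter> (W q - K) = (W m \<inter> W q) - (W m \<inter> K)" by auto
      moreover have "W m \<inter> K \<subseteq> W m \<inter> W q" using KQ[OF q] by auto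
      ultimately have "card (W m \<inter> (W q - K)) = card (W m \<inter> W q) - card (W m \<inter> K)"
        using finK by (simp add: card_Diff_subset)
      moreover have "q \<in> M" "m \<noteq> q" using q QM mQ by auto
      ultimately show ?thesis using c2[of m q] m by simp
    qed
    have "card (\<Union>q\<in>?Q. W m \<inter> (W q - K)) = (\<Sum>q\<in>?Q. card (W m \<inter> (W q - K)))"
    proof (rule card_UN_disjoint)
      show "finite ?Q" using finQ by simp
      show "\<forall>q\<in>?Q. finite (W m \<inter> (W q - K))" using finW[OF m] by simp
      show "\<forall>q\<in>?Q. \<forall>q'\<in>?Q. q \<noteq> q' \<longrightarrow> (W m \<inter> (W q - K)) \<inter> (W m \<inter> (W q' - K)) = {}"
        using inter KQ QM by blast
    qed
    also have "\<dots> = 4 * (2 - card (W m \<inter> K))" using pet cQ by simp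
    finally have u: "card (\<Union>q\<in>?Q. W m \<inter> (W q - K)) = 4 * (2 - card (W m \<inter> K))" .
    have "card ((\<Union>q\<in>?Q. W m \<inter> (W q - K)) \<union> (W m \<inter> K))
        = card (\<Union>q\<in>?Q. W m \<inter> (W q - K)) + card (W m \<inter> K)"
      by (rule card_Un_disjoint) (use finW[OF m] finK finQ in auto)
    moreover have "card ((\<Union>q\<in>?Q. W m \<inter> (W q - K)) \<union> (W m \<inter> K)) \<le> card (W m)"
      by (rule card_mono) (use finW[OF m] in auto)
    ultimately show False using u lt c4[OF m] by simp
  qed
  show thesis by (rule that[of K]) (use K KM inter in auto)
qed

text \<open>The kernel of the sunflower is a norm 2 vector \<open>u\<close>, and the petals \<open>w m - u\<close> have
  disjoint supports, so \<open>y\<close> meets at most one petal per coordinate of its support.\<close>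

lemma sunflower_kernel:
  assumes fin: "finite M" and M: "card M \<ge> 14"
    and fl: "\<And>m. m \<in> M \<Longrightarrow> flat n (w m)"
    and dfl: "\<And>m m'. m \<in> M \<Longrightarrow> m' \<in> M \<Longrightarrow> m \<noteq> m' \<Longrightarrow> flat n (\<lambda>i. w m i - w m' i)"
    and n4: "\<And>m. m \<in> M \<Longrightarrow> std_inner n (w m) (w m) = 4"
    and n2: "\<And>m m'. m \<in> M \<Longrightarrow> m' \<in> M \<Longrightarrow> m \<noteq> m' \<Longrightarrow> std_inner n (w m) (w m') = 2"
  obtains u where "std_inner n u u = 2" "\<forall>i\<ge>n. u i = 0"
    "\<And>y. card {m \<in> M. std_inner n y (w m) \<noteq> std_inner n y u} \<le> card {i. i < n \<and> y i \<noteq> 0}"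
proof -
  let ?W = "\<lambda>m. signed_support n (w m)"
  have c4: "card (?W m) = 4" if "m \<in> M" for m
    using std_inner_flat_self[OF fl[OF that]] n4[OF that] by simp
  have c2: "card (?W m \<inter> ?W m') = 2" if "m \<in> M" "m' \<in> M" "m \<noteq> m'" for m m'
    using std_inner_flat[OF fl fl dfl, OF that(1,2) that] n2[OF that] by simp
  obtain K where K: "card K = 2" "\<And>m. m \<in> M \<Longrightarrow> K \<subseteq> ?W m"
    "\<And>m m'. m \<in> M \<Longrightarrow> m' \<in> M \<Longrightarrow> m \<noteq> m' \<Longrightarrow> ?W m \<inter> ?W m' = K"
    using sunflower_four_two[OF fin M, of ?W] c4 c2 by blast
  obtain p where p: "p \<in> M" using M by fastforce
  define u where "u = (\<lambda>i. if (i, w p i) \<in> K then w p i else 0)"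
  \<comment> \<open>The choice of \<open>p\<close> is immaterial: \<open>K\<close> lies in every
    signed support and thus prescribes the same values for all \<open>w m\<close>.\<close>
  have u: "u i = (if (i, w m i) \<in> K then w m i else 0)" if m: "m \<in> M" for m i
    using K(2)[OF m] K(2)[OF p] by (fastforce simp: u_def mem_signed_support)
  have u0: "\<forall>i\<ge>n. u i = 0" using K(2)[OF p] by (fastforce simp: u_def mem_signed_support)
  have "(i, c) \<in> signed_support n u \<longleftrightarrow> (i, c) \<in> K" for i c
    using K(2)[OF p] by (fastforce simp: u_def mem_signed_support)
  then have sK: "signed_support n u = K" by auto
  have "flat n u" using fl[OF p] by (auto simp: flat_def u_def)
  then have uu: "std_inner n u u = 2" using std_inner_flat_self[of n u] sK K(1) by simp
  have "card {m \<in> M. std_inner n y (w m) \<noteq> std_inner n y u} \<le> card {i. i < n \<and> y i \<noteq> 0}" for y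
  proof -
    let ?B = "{m \<in> M. std_inner n y (w m) \<noteq> std_inner n y u}"
    have ex: "\<exists>i. i < n \<and> y i \<noteq> 0 \<and> w m i \<noteq> u i" if "m \<in> ?B" for m
    proof (rule ccontr)
      assume "\<not> ?thesis"
      then have "std_inner n y (w m) = std_inner n y u"
        unfolding std_inner_def by (intro sum.cong) auto
      with that show False by simp
    qed
    then obtain g where g: "\<And>m. m \<in> ?B \<Longrightarrow> g m < n \<and> y (g m) \<noteq> 0 \<and> w m (g m) \<noteq> u (g m)"
      by metis
    \<comment> \<open>Two bad indices sharing a coordinate would have nonzero values there that
      differ by at most 1, hence agree. The common point would lie in \<open>K\<close>, where
      \<open>w m\<close> equals \<open>u\<close>.\<close>
    have "inj_on g ?B"
    proof (rule inj_onI, rule ccontr)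
      fix m m' assume mm: "m \<in> ?B" "m' \<in> ?B" "g m = g m'" "m \<noteq> m'"
      define i where "i = g m"
      have i: "i < n" "w m i \<noteq> u i" "w m' i \<noteq> u i" using g mm unfolding i_def by metis+
      have nz: "w m i \<noteq> 0" "(i, w m i) \<notin> K" "w m' i \<noteq> 0"
        using i u[of m i] u[of m' i] mm by (auto split: if_splits)
      have "\<bar>w m i\<bar> \<le> 1" "\<bar>w m' i\<bar> \<le> 1" "\<bar>w m i - w m' i\<bar> \<le> 1"
        using fl[of m] fl[of m'] dfl[of m m'] mm i by (auto simp: flat_def)
      then have "w m i = w m' i" using nz by (auto dest!: abs_le_oneD)
      then have "(i, w m i) \<in> ?W m \<inter> ?W m'" using nz i by (simp add: mem_signed_support)
      then show False using K(3)[of m m'] mm nz by auto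
    qed
    then show ?thesis by (rule card_inj_on_le) (use g in auto)
  qed
  then show thesis using that uu u0 by blast
qed

subsection \<open>Embeddings of the root lattice of type A\<close>

text \<open>The roots form a path that visits \<open>\<sigma> 0\<close>, \<open>\<sigma> 1\<close>,
  and so on. Orthogonality to the earlier roots makes the next root constant on the vertices
  \<open>\<sigma> 0\<close> to \<open>\<sigma> j\<close>; the constant is 0, and adjacency then puts
  its entry -1 at \<open>\<sigma> (Suc j)\<close>.\<close>

lemma dif_chain_oriented:
  assumes lt: "\<And>j. j < m \<Longrightarrow> a j < n \<and> b j < n \<and> a j \<noteq> b j"
    and adj: "\<And>j. Suc j < m \<Longrightarrow> std_inner n (dif (a (Suc j)) (b (Suc j))) (dif (a j) (b j)) = -1"
    and orth: "\<And>j l. j < m \<Longrightarrow> l < m \<Longrightarrow> Suc l < j \<Longrightarrow> std_inner n (dif (a j) (b j)) (dif (a l) (b l)) = 0"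
    and m: "m \<ge> 2" and start: "b 1 = a 0"
    and \<sigma>: "\<sigma> = (\<lambda>j. if j = 0 then b 0 else a (j - 1))"
  shows "j < m \<Longrightarrow> (\<forall>l\<le>j. b l = \<sigma> l) \<and> inj_on \<sigma> {..Suc j}"
proof (induction j)
  case 0
  then have "b 0 \<noteq> a 0" using lt[of 0] by auto
  then show ?case by (auto simp: \<sigma> inj_on_def le_Suc_eq)
next
  case (Suc j)
  then have IH: "\<forall>l\<le>j. b l = \<sigma> l" and inj: "inj_on \<sigma> {..Suc j}" by auto
  let ?V = "dif (a (Suc j)) (b (Suc j))"
  have \<sigma>S: "\<sigma> (Suc l) = a l" for l by (simp add: \<sigma>)
  have st: "?V (\<sigma> (Suc l)) = ?V (\<sigma> l)" if "l < j" for l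
  proof -
    have "?V (a l) - ?V (b l) = 0"
      using orth[of "Suc j" l] Suc.prems that lt[of l] by (simp add: std_inner_dif)
    moreover have "b l = \<sigma> l" using IH that by simp
    ultimately show ?thesis using \<sigma>S by simp
  qed
  have const: "l \<le> j \<Longrightarrow> ?V (\<sigma> l) = ?V (\<sigma> 0)" for l
    by (induction l) (use st in auto)
  have last: "?V (\<sigma> (Suc j)) = ?V (\<sigma> j) - 1"
  proof -
    have "?V (a j) - ?V (b j) = -1" using adj[of j] Suc.prems lt[of j] by (simp add: std_inner_dif)
    moreover have "b j = \<sigma> j" using IH by simp
    ultimately show ?thesis using \<sigma>S by simp
  qed
  have ab: "a (Suc j) \<noteq> b (Suc j)" using lt Suc.prems by blast
  \<comment> \<open>A root takes neither of the values 1 and -1 twice, so being constant on two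
    vertices means vanishing there. For \<open>j = 0\<close> there is only one vertex, and
    \<open>start\<close> decides.\<close>
  have V0: "?V (\<sigma> 0) = 0"
  proof (cases "j = 0")
    case True
    have "b (Suc 0) \<noteq> b 0" using start lt[of 0] Suc.prems by auto
    moreover have "a (Suc 0) \<noteq> b 0"
    proof
      assume "a (Suc 0) = b 0"
      then have "std_inner n (dif (b 0) (a 0)) (dif (a 0) (b 0)) = -1"
        using adj[of 0] start Suc.prems True by simp
      then show False using lt[of 0] Suc.prems by (simp add: std_inner_dif) (simp add: dif_def)
    qed
    ultimately show ?thesis using True by (simp add: dif_def \<sigma>)
  next
    case False
    then have e: "?V (\<sigma> 1) = ?V (\<sigma> 0)" using const[of 1] by simp
    have "\<sigma> 1 \<noteq> \<sigma> 0" using inj False by (auto simp: inj_on_def)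
    then show ?thesis using e ab by (auto simp: dif_def of_bool_def split: if_splits)
  qed
  then have "?V (\<sigma> (Suc j)) = -1" using last const[of j] by simp
  then have b: "b (Suc j) = \<sigma> (Suc j)" by (auto simp: dif_def of_bool_def split: if_splits)
  have "\<sigma> (Suc (Suc j)) \<noteq> \<sigma> l" if "l \<le> Suc j" for l
  proof (cases "l = Suc j")
    case True
    then show ?thesis using b ab by (simp add: \<sigma>)
  next
    case False
    then have "?V (\<sigma> l) = 0" using const[of l] V0 that by simp
    then show ?thesis using ab by (auto simp: \<sigma> dif_def of_bool_def split: if_splits)
  qed
  then have "inj_on \<sigma> {..Suc (Suc j)}"
    using inj by (subst atMost_Suc) (auto simp: inj_on_insert)
  moreover have "\<forall>l\<le>Suc j. b l = \<sigma> l" using IH b by (auto simp: le_Suc_eq)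
  ultimately show ?case by blast
qed

lemma std_inner_dif_swap:
  "std_inner n (dif a b) (dif c d) = std_inner n (dif b a) (dif d c)"
  by (simp add: std_inner_def dif_def algebra_simps)

text \<open>The Gram matrix makes each \<open>U j\<close> a root, and the roots form a path. Its
  orientation can be read off from the first two roots; reversing all of them accounts for the
  sign.\<close>

lemma type_A_embedding:
  assumes n: "n \<ge> 3"
    and z: "\<And>j i. Suc j < n \<Longrightarrow> i \<ge> n \<Longrightarrow> U j i = 0"
    and s0: "\<And>j. Suc j < n \<Longrightarrow> (\<Sum>i<n. U j i) = 0"
    and gram: "\<And>j l. Suc j < n \<Longrightarrow> Suc l < n \<Longrightarrow>
      std_inner n (U j) (U l) = std_inner n (dif (Suc j) j) (dif (Suc l) l)"
  obtains \<epsilon> \<sigma> where "inj_on \<sigma> {..<n}" "\<sigma> ` {..<n} \<subseteq> {..<n}" "\<epsilon> = 1 \<or> \<epsilon> = -1"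
    "\<And>j k. Suc j < n \<Longrightarrow> U j k = \<epsilon> * dif (\<sigma> (Suc j)) (\<sigma> j) k"
proof -
  note result = that
  \<comment> \<open>Endpoints and sign are left free so that the other orientation can be treated by
    the same argument, with \<open>a\<close> and \<open>b\<close> exchanged.\<close>
  have oriented: thesis
    if lt: "\<And>j. Suc j < n \<Longrightarrow> a j < n \<and> b j < n \<and> a j \<noteq> b j"
      and U: "\<And>j k. Suc j < n \<Longrightarrow> U j k = \<epsilon> * dif (a j) (b j) k"
      and adj: "\<And>j. Suc (Suc j) < n \<Longrightarrow> std_inner n (dif (a (Suc j)) (b (Suc j))) (dif (a j) (b j)) = -1"
      and orth: "\<And>j l. Suc j < n \<Longrightarrow> Suc l < j \<Longrightarrow> std_inner n (dif (a j) (b j)) (dif (a l) (b l)) = 0"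
      and start: "b 1 = a 0" and \<epsilon>: "\<epsilon> = 1 \<or> \<epsilon> = -1"
    for a b and \<epsilon> :: int
  proof -
    define \<sigma> where "\<sigma> = (\<lambda>j. if j = 0 then b 0 else a (j - 1))"
    have ch: "(\<forall>l\<le>j. b l = \<sigma> l) \<and> inj_on \<sigma> {..Suc j}" if "j < n - 1" for j
    proof (rule dif_chain_oriented[of "n - 1" a n b, OF _ _ _ _ start \<sigma>_def that])
      show "2 \<le> n - 1" using n by simp
    qed (use lt adj orth in simp_all)
    have "{..<n} = {..Suc (n - 2)}" using n by auto
    then have inj: "inj_on \<sigma> {..<n}" using ch[of "n - 2"] n by simp
    have img: "\<sigma> ` {..<n} \<subseteq> {..<n}"
    proof -
      have "\<sigma> j < n" if "j < n" for j
        using lt[of 0] lt[of "j - 1"] n that by (cases j) (simp_all add: \<sigma>_def)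
      then show ?thesis by auto
    qed
    show thesis
    proof (rule result[OF inj img \<epsilon>])
      fix j k assume j: "Suc j < n"
      then have "b j = \<sigma> j" using ch[of j] by simp
      moreover have "a j = \<sigma> (Suc j)" by (simp add: \<sigma>_def)
      ultimately show "U j k = \<epsilon> * dif (\<sigma> (Suc j)) (\<sigma> j) k" using U[OF j] by simp
    qed
  qed
  have "\<exists>a b. a < n \<and> b < n \<and> a \<noteq> b \<and> U j = dif a b" if "Suc j < n" for j
  proof (rule norm_two_eq_dif)
    show "std_inner n (U j) (U j) = 2"
      using gram[OF that that] that by (simp add: std_inner_dif) (simp add: dif_def)
  qed (use that z s0 in auto)
  then obtain a b where ab: "\<And>j. Suc j < n \<Longrightarrow> a j < n \<and> b j < n \<and> a j \<noteq> b j \<and> U j = dif (a j) (b j)"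
    by metis
  have adj: "std_inner n (dif (a (Suc j)) (b (Suc j))) (dif (a j) (b j)) = -1" if "Suc (Suc j) < n" for j
    using gram[of "Suc j" j] ab[of j] ab[of "Suc j"] that by (simp add: std_inner_dif) (simp add: dif_def)
  have orth: "std_inner n (dif (a j) (b j)) (dif (a l) (b l)) = 0" if "Suc j < n" "Suc l < j" for j l
    using gram[of j l] ab[of j] ab[of l] that by (simp add: std_inner_dif) (simp add: dif_def)
  \<comment> \<open>Inner product -1 means that the two roots share a vertex at which their entries
    are opposite.\<close>
  have "dif (a 1) (b 1) (a 0) - dif (a 1) (b 1) (b 0) = -1"
    using adj[of 0] n ab[of 0] by (simp add: std_inner_dif)
  then have "b 1 = a 0 \<or> a 1 = b 0"
    by (auto simp: dif_def of_bool_def split: if_splits)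
  then show thesis
  proof
    assume "b 1 = a 0"
    then show thesis using ab adj orth by (intro oriented[of a b 1]) auto
  next
    assume start: "a 1 = b 0"
    show thesis
    proof (rule oriented[of b a "-1"])
      show "U j k = -1 * dif (b j) (a j) k" if "Suc j < n" for j k
        using ab[OF that] by (simp add: dif_def)
      show "b j < n \<and> a j < n \<and> b j \<noteq> a j" if "Suc j < n" for j
        using ab[OF that] by simp
    qed (use adj orth start in \<open>simp_all add: std_inner_dif_swap[of n "b _"]\<close>)
  qed
qed

subsection \<open>Isometries act affinely on the coefficients\<close>

lemma lat_add: "x \<in> lat n s \<Longrightarrow> y \<in> lat n s \<Longrightarrow> (\<lambda>i. x i + y i) \<in> lat n s"
  by (simp add: lat_def sum.distrib distrib_left)

lemma dif_dif_mem_lat: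
  assumes "a < n" "b < n" "c < n" "e < n" "s a + s c = s b + s e"
  shows "(\<lambda>k. dif a b k + dif c e k) \<in> lat n s"
proof -
  have "(\<Sum>i<n. int (s i) * (dif a b i + dif c e i)) = int (s a) - int (s b) + (int (s c) - int (s e))"
    using assms by (simp add: distrib_left sum.distrib sum_mult_dif)
  also have "\<dots> = 0" using assms(5) by linarith
  finally show ?thesis
    using assms by (auto simp: lat_def sum.distrib sum_dif) (auto simp: dif_def)
qed

lemma norm_dif_dif:
  assumes "a < n" "b < n" "c < n" "e < n" "distinct [a, b, c, e]"
  shows "std_inner n (\<lambda>k. dif a b k + dif c e k) (\<lambda>k. dif a b k + dif c e k) = 4"
  using assms by (simp add: std_inner_add_right std_inner_dif) (simp add: dif_def)

text \<open>Integers satisfy \<open>\<bar>a\<bar> \<le> a * a\<close>. Together with the parity of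
  the sum, this bound later shows that the kernel vector \<open>u\<close> has coordinate sum
  zero.\<close>

lemma abs_sum_le_norm: "\<bar>\<Sum>i<n. x i\<bar> \<le> std_inner n x x"
proof -
  have "\<bar>a\<bar> \<le> a * a" for a :: int
  proof (cases "a = 0")
    case False
    then have "\<bar>a\<bar> * 1 \<le> \<bar>a\<bar> * \<bar>a\<bar>" by (intro mult_left_mono) auto
    then show ?thesis by (simp add: abs_mult_self_eq)
  qed simp
  then show ?thesis unfolding std_inner_def
    by (intro order_trans[OF sum_abs] sum_mono)
qed

lemma even_sum_iff_even_norm: "even (\<Sum>i<n. x i) \<longleftrightarrow> even (std_inner n x x)"
  by (induction n) (auto simp: std_inner_def)

text \<open>The bound on \<open>n\<close> makes room for the 15 pairs, \<open>init\<close> supplies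
  the relations that split lattice vectors into norm 4 vectors, and \<open>lastgap\<close> forces
  \<open>u\<close> into the root lattice.\<close>

lemma isometry_affine:
  fixes s s' :: "nat \<Rightarrow> nat" and f :: "(nat \<Rightarrow> int) \<Rightarrow> nat \<Rightarrow> int"
  assumes n: "n \<ge> 48"
    and gap: "\<And>j. s (Suc j) = s j + 1 \<or> s (Suc j) = s j + 2"
    and gap2: "\<And>j. s (Suc j) = s j + 2 \<Longrightarrow> s (Suc (Suc j)) = s (Suc j) + 1"
    and init: "\<And>j. j < 6 \<Longrightarrow> s j = Suc j"
    and lastgap: "s (n - 1) = s (n - 2) + 2"
    and f_mem: "\<And>x. x \<in> lat n s \<Longrightarrow> f x \<in> lat n s'"
    and f_add: "\<And>x y. x \<in> lat n s \<Longrightarrow> y \<in> lat n s \<Longrightarrow> f (\<lambda>i. x i + y i) = (\<lambda>i. f x i + f y i)"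
    and f_iso: "\<And>x y. x \<in> lat n s \<Longrightarrow> y \<in> lat n s \<Longrightarrow> std_inner n (f x) (f y) = std_inner n x y"
  obtains \<sigma> a C where "bij_betw \<sigma> {..<n} {..<n}"
    "\<And>j. j < n \<Longrightarrow> int (s' (\<sigma> j)) = C + a * int (s j)"
proof -
  let ?I = "std_inner n" and ?\<beta> = "dif (Suc 0) 0"
  \<comment> \<open>Two consecutive gaps are not both 2, so each block \<open>{3m, 3m+1, 3m+2}\<close> contains a pair with gap 1.\<close>
  define p where "p m = (if s (Suc (3 * m)) = s (3 * m) + 1 then 3 * m else Suc (3 * m))" for m
  define v where "v m = (\<lambda>k. ?\<beta> k + dif (p m) (Suc (p m)) k)" for m
  \<comment> \<open>Block 0 is left out because \<beta> 0 lives there. The last coordinate reached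
    is at most 47.\<close>
  define M where "M = {1..15::nat}"
  have p_gap: "s (Suc (p m)) = s (p m) + 1" for m
    using gap[of "3 * m"] gap2[of "3 * m"] by (auto simp: p_def)
  have p_rng: "3 * m \<le> p m" "p m \<le> 3 * m + 1" for m by (auto simp: p_def)
  have p_M: "3 \<le> p m" "Suc (p m) < n" if "m \<in> M" for m
    using p_rng[of m] that n by (auto simp: M_def)
  have v_mem: "v m \<in> lat n s" if "m \<in> M" for m
    unfolding v_def using p_M[OF that] p_gap[of m] init[of 0] init[of 1] n
    by (intro dif_dif_mem_lat) auto
  have v_norm: "?I (v m) (v m) = 4" if "m \<in> M" for m
    unfolding v_def using p_M[OF that] n by (intro norm_dif_dif) auto
  have v_ip: "?I (v m) (v m') = 2" if "m \<in> M" "m' \<in> M" "m \<noteq> m'" for m m'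
  proof -
    have "p m + 1 < p m' \<or> p m' + 1 < p m"
      using p_rng[of m] p_rng[of m'] that(3) by linarith
    then show ?thesis
      unfolding v_def[of m'] using p_M[OF that(1)] p_M[OF that(2)] n
      by (simp add: std_inner_add_right std_inner_dif) (auto simp: v_def dif_def)
  qed
  have fz: "(\<Sum>i<n. f x i) = 0" "\<forall>i\<ge>n. f x i = 0" "(\<Sum>i<n. int (s' i) * f x i) = 0"
    if "x \<in> lat n s" for x
    using f_mem[OF that] by (auto simp: lat_def)
  have ff: "flat n (f (v m))" if "m \<in> M" for m
    using that v_mem v_norm by (intro flat_norm_four) (auto simp: f_iso fz)
  have fd: "flat n (\<lambda>i. f (v m) i - f (v m') i)" if "m \<in> M" "m' \<in> M" "m \<noteq> m'" for m m'
    using that v_mem v_norm v_ip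
    by (intro flat_norm_four) (auto simp: f_iso fz std_inner_simps sum_subtractf)
  obtain u where u2: "?I u u = 2" and uz: "\<forall>i\<ge>n. u i = 0"
    and bad: "\<And>y. card {m \<in> M. ?I y (f (v m)) \<noteq> ?I y u} \<le> card {i. i < n \<and> y i \<noteq> 0}"
  proof (rule sunflower_kernel[of M n "\<lambda>m. f (v m)"])
    show "finite M" "14 \<le> card M" by (simp_all add: M_def)
  qed (use ff fd v_mem v_norm v_ip in \<open>auto simp: f_iso\<close>)
  have supp4: "card {i. i < n \<and> y i \<noteq> 0} = 4" if "?I y y = 4" "(\<Sum>i<n. y i) = 0" for y
    using std_inner_flat_self[OF flat_norm_four[OF that]] that by (simp add: card_support)
  \<comment> \<open>\<open>P x\<close> says that \<open>u\<close> pairs with the image of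
    \<open>x\<close> as \<beta> 0 pairs with \<open>x\<close>. It is additive, so it only has to be
    checked on norm 4 vectors.\<close>
  define P where "P x \<longleftrightarrow> x \<in> lat n s \<and> ?I (f x) u = ?I x ?\<beta>" for x
  \<comment> \<open>At most 4 indices fail on the image side by \<open>bad\<close>, and at most 4 on
    the source side, since each such block meets the support of \<open>y\<close>. For one of the
    remaining indices, \<open>v m\<close> transports the pairing through \<open>f\<close>.\<close>
  have P4: "P y" if y: "y \<in> lat n s" "?I y y = 4" for y
  proof -
    let ?B1 = "{m \<in> M. ?I (f y) (f (v m)) \<noteq> ?I (f y) u}"
    let ?B2 = "{m \<in> M. ?I y (v m) \<noteq> ?I y ?\<beta>}"
    have y0: "(\<Sum>i<n. y i) = 0" using y by (simp add: lat_def)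
    have B1: "card ?B1 \<le> 4"
      using bad[of "f y"] supp4[of "f y"] y fz(1)[OF y(1)] by (simp add: f_iso)
    have "?B2 \<subseteq> (\<lambda>i. i div 3) ` {i. i < n \<and> y i \<noteq> 0}"
    proof
      fix m assume m: "m \<in> ?B2"
      then have "y (p m) \<noteq> 0 \<or> y (Suc (p m)) \<noteq> 0"
        using p_M[of m] by (auto simp: v_def std_inner_add_right std_inner_dif)
      moreover have "p m div 3 = m" "Suc (p m) div 3 = m" using p_rng[of m] by linarith+
      moreover have "p m < n" "Suc (p m) < n" using m p_M[of m] by auto
      ultimately show "m \<in> (\<lambda>i. i div 3) ` {i. i < n \<and> y i \<noteq> 0}"
        by (metis (mono_tags, lifting) imageI mem_Collect_eq)
    qed
    then have "card ?B2 \<le> card ((\<lambda>i. i div 3) ` {i. i < n \<and> y i \<noteq> 0})"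
      by (rule card_mono[rotated]) simp
    also have "\<dots> \<le> 4" using card_image_le[of "{i. i < n \<and> y i \<noteq> 0}" "\<lambda>i. i div 3"] supp4[OF y(2) y0] by simp
    finally have "card (?B1 \<union> ?B2) \<le> 8" using B1 card_Un_le[of ?B1 ?B2] by linarith
    moreover have "card M = 15" "finite M" by (simp_all add: M_def)
    ultimately have "\<not> M \<subseteq> ?B1 \<union> ?B2" using card_mono[of "?B1 \<union> ?B2" M] by auto
    then obtain m where "m \<in> M" "?I (f y) (f (v m)) = ?I (f y) u" "?I y (v m) = ?I y ?\<beta>" by auto
    then show ?thesis using y v_mem by (simp add: P_def f_iso)
  qed
  have P_add: "P (\<lambda>i. x i + y i)" if "P x" "P y" for x y
    using that by (simp add: P_def lat_add f_add std_inner_add_left)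
  have P0: "P (\<lambda>_. 0)"
  proof -
    have z: "(\<lambda>_. 0) \<in> lat n s" by (simp add: lat_def)
    have "f (\<lambda>_. 0) = (\<lambda>_. 0)" using f_add[OF z z] by (auto simp: fun_eq_iff)
    then show ?thesis using z by (simp add: P_def std_inner_def)
  qed
  have Pq: "P (\<lambda>k. dif a b k + dif c e k)"
    if "a < n" "b < n" "c < n" "e < n" "distinct [a, b, c, e]" "s a + s c = s b + s e" for a b c e
    using that by (intro P4 dif_dif_mem_lat norm_dif_dif) auto
  define g where "g j = int (s (Suc j)) - int (s j)" for j
  \<comment> \<open>As \<open>s 1 - s 0 = 1\<close>, the multiple \<open>g j\<close> of \<beta> 0
    has the same value under the linear form as \<beta> j, so the difference lies in the
    lattice.\<close>
  define X where "X j = (\<lambda>k. dif (Suc j) j k - g j * ?\<beta> k)" for j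
  \<comment> \<open>Here \<beta> 1 and \<beta> 0 overlap and \<open>X 1\<close> has norm 6. It is
    split into two norm 4 vectors whose entries at 3 and 4 cancel.\<close>
  have X1: "P (X 1)"
  proof -
    have "P (\<lambda>k. (dif 2 1 k + dif 3 4 k) + (dif 4 3 k + dif 0 1 k))"
      using n init by (intro P_add Pq) auto
    also have "(\<lambda>k. (dif 2 1 k + dif 3 4 k) + (dif 4 3 k + dif 0 1 k)) = X 1"
      using init[of 1] init[of 2] by (auto simp: X_def g_def dif_def fun_eq_iff numeral_2_eq_2)
    finally show ?thesis .
  qed
  have PX: "P (X j)" if j: "Suc j < n" for j
  proof (cases "s (Suc j) = s j + 1")
    case True
    then have gj: "g j = 1" by (simp add: g_def)
    consider "j = 0" | "j = 1" | "j \<ge> 2" by linarith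
    then show ?thesis
    proof cases
      case 1
      then have "X j = (\<lambda>_. 0)" using gj by (auto simp: X_def)
      then show ?thesis using P0 by simp
    next
      case 3
      then have "P (\<lambda>k. dif (Suc j) j k + dif 0 1 k)"
        using j True init[of 0] init[of 1] by (intro Pq) auto
      also have "(\<lambda>k. dif (Suc j) j k + dif 0 1 k) = X j"
        using gj by (auto simp: X_def dif_def fun_eq_iff)
      finally show ?thesis .
    qed (use X1 in simp)
  next
    case False
    then have s2: "s (Suc j) = s j + 2" using gap by blast
    have "j \<ge> 5"
    proof (rule ccontr)
      assume "\<not> j \<ge> 5"
      then show False using s2 init[of j] init[of "Suc j"] by simp
    qed
    \<comment> \<open>The gap 2 is balanced by the step from 2 to 0, which gives a norm 4 vector;
      adding \<open>X 1\<close> turns that step into -2 times \<beta> 0.\<close>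
    then have "P (\<lambda>k. (dif (Suc j) j k + dif 0 2 k) + X 1 k)"
      using j s2 init[of 0] init[of 2] by (intro P_add Pq X1) auto
    also have "(\<lambda>k. (dif (Suc j) j k + dif 0 2 k) + X 1 k) = X j"
      using s2 init[of 1] init[of 2]
      by (auto simp: X_def g_def dif_def fun_eq_iff numeral_2_eq_2)
    finally show ?thesis .
  qed
  \<comment> \<open>The image of \<beta> j under the extension of \<open>f\<close> that sends
    \<beta> 0 to \<open>u\<close>.\<close>
  define U where "U j = (\<lambda>k. f (X j) k + g j * u k)" for j
  have gram: "?I (U j) (U l) = ?I (dif (Suc j) j) (dif (Suc l) l)" if "Suc j < n" "Suc l < n" for j l
  proof -
    have e: "dif (Suc i) i = (\<lambda>k. X i k + g i * ?\<beta> k)" for i by (simp add: X_def)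
    have b2: "?I ?\<beta> ?\<beta> = 2" using n by (simp add: std_inner_dif) (simp add: dif_def)
    have "?I (f (X j)) (f (X l)) = ?I (X j) (X l)" "?I (f (X j)) u = ?I (X j) ?\<beta>"
      "?I u (f (X l)) = ?I ?\<beta> (X l)"
      using PX[OF that(1)] PX[OF that(2)]
      by (auto simp: P_def f_iso std_inner_commute[of n u] std_inner_commute[of n ?\<beta>])
    then show ?thesis unfolding U_def e[of j] e[of l] using u2 b2
      by (simp add: std_inner_simps)
  qed
  have XL: "X j \<in> lat n s" if "Suc j < n" for j using PX[OF that] by (simp add: P_def)
  have sumU: "(\<Sum>i<n. U j i) = g j * (\<Sum>i<n. u i)" if "Suc j < n" for j
    using fz(1)[OF XL[OF that]] by (simp add: U_def sum.distrib sum_distrib_left)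
  \<comment> \<open>\<open>u\<close> need not lie in the image of \<open>f\<close>, so its sum has
    to be computed. The last gap is 2, hence the norm 2 vector \<open>U k\<close> has twice the sum
    of \<open>u\<close>; this leaves absolute value at most 1, and the sum is even.\<close>
  have u_sum: "(\<Sum>i<n. u i) = 0"
  proof -
    obtain k where k: "n = Suc (Suc k)" using n by (intro that[of "n - 2"]) simp
    have "g k = 2" using lastgap k by (simp add: g_def)
    moreover have "?I (U k) (U k) = 2"
      using gram[of k k] k by (simp add: std_inner_dif) (simp add: dif_def)
    ultimately have "\<bar>2 * (\<Sum>i<n. u i)\<bar> \<le> 2" using abs_sum_le_norm[where n=n and x="U k"] sumU[of k] k by simp
    moreover have "even (\<Sum>i<n. u i)" using u2 by (simp add: even_sum_iff_even_norm)
    ultimately show ?thesis by (auto elim!: evenE)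
  qed
  have Uz: "U j i = 0" if "Suc j < n" "i \<ge> n" for i j
    using that fz(2)[OF XL[OF that(1)]] uz by (simp add: U_def)
  have Us: "(\<Sum>i<n. U j i) = 0" if "Suc j < n" for j
    using sumU[OF that] u_sum by simp
  obtain \<epsilon> \<sigma> where \<sigma>: "inj_on \<sigma> {..<n}" "\<sigma> ` {..<n} \<subseteq> {..<n}" and \<epsilon>: "\<epsilon> = 1 \<or> \<epsilon> = -1"
    and U: "\<And>j k. Suc j < n \<Longrightarrow> U j k = \<epsilon> * dif (\<sigma> (Suc j)) (\<sigma> j) k"
    by (rule type_A_embedding[of n U, OF _ Uz Us gram]) (use n in auto)
  define a where "a = \<epsilon> * (\<Sum>i<n. int (s' i) * u i)"
  \<comment> \<open>The form given by \<open>s'\<close> vanishes on \<open>f (X j)\<close>, so on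
    \<open>U j\<close> only the multiple \<open>g j\<close> of \<open>u\<close> contributes.\<close>
  have step: "int (s' (\<sigma> (Suc j))) - int (s' (\<sigma> j)) = a * g j" if j: "Suc j < n" for j
  proof -
    have "(\<Sum>i<n. int (s' i) * U j i) = g j * (\<Sum>i<n. int (s' i) * u i)"
      using fz(3)[OF XL[OF j]]
      by (simp add: U_def distrib_left sum.distrib sum_distrib_left mult.left_commute)
    moreover have "(\<Sum>i<n. int (s' i) * U j i) = \<epsilon> * (\<Sum>i<n. int (s' i) * dif (\<sigma> (Suc j)) (\<sigma> j) i)"
      using U[OF j] by (simp add: sum_distrib_left mult.left_commute)
    moreover have "\<dots> = \<epsilon> * (int (s' (\<sigma> (Suc j))) - int (s' (\<sigma> j)))"
      using \<sigma>(2) j by (subst sum_mult_dif) (auto simp: image_subset_iff)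
    ultimately have "\<epsilon> * (int (s' (\<sigma> (Suc j))) - int (s' (\<sigma> j))) = g j * (\<Sum>i<n. int (s' i) * u i)"
      by simp
    then show ?thesis using \<epsilon> by (auto simp: a_def algebra_simps)
  qed
  have "int (s' (\<sigma> j)) = (int (s' (\<sigma> 0)) - a * int (s 0)) + a * int (s j)" if "j < n" for j
    using that
  proof (induction j)
    case (Suc j)
    then show ?case using step[of j] by (simp add: g_def algebra_simps)
  qed simp
  moreover have "bij_betw \<sigma> {..<n} {..<n}"
    using \<sigma> by (simp add: bij_betw_def endo_inj_surj)
  ultimately show thesis using that by blast
qed

subsection \<open>The coefficients of a spaced hole sequence\<close>

locale spaced_holes =
  fixes d :: nat and hs :: "nat list"
  assumes d: "d \<ge> 46"
    and hs: "hs \<noteq> []" "sorted_wrt (<) hs" "hd hs \<ge> 7"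
    and last_hole: "last hs = d + length hs + 1"
    and spacing: "\<forall>i. i + 1 < length hs \<longrightarrow> hs ! i + 4 \<le> hs ! (i + 1)"
begin

lemma hole_spacing:
  assumes "h \<in> set hs" "h' \<in> set hs" "h < h'"
  shows "h + 4 \<le> h'"
proof -
  obtain i j where ij: "i < length hs" "h = hs ! i" "j < length hs" "h' = hs ! j"
    using assms by (metis in_set_conv_nth)
  have "i < j"
  proof (rule ccontr)
    assume "\<not> i < j"
    then have "hs ! j \<le> hs ! i" using sorted_wrt_nth_less[OF hs(2), of j i] ij
      by (cases "i = j") auto
    then show False using assms(3) ij by simp
  qed
  then have "hs ! i + 4 \<le> hs ! (i + 1)" using spacing ij by simp
  also have "\<dots> \<le> hs ! j"
    using sorted_wrt_nth_less[OF hs(2), of "i + 1" j] ij \<open>i < j\<close> by (cases "i + 1 = j") auto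
  finally show ?thesis using ij by simp
qed

lemma hole_bounds:
  assumes "h \<in> set hs"
  shows "7 \<le> h" "h \<le> d + length hs + 1"
proof -
  obtain i where i: "i < length hs" "h = hs ! i" using assms by (metis in_set_conv_nth)
  have "hs ! 0 \<le> hs ! i"
    using sorted_wrt_nth_less[OF hs(2), of 0 i] i by (cases "i = 0") auto
  then show "7 \<le> h" using hs i by (simp add: hd_conv_nth)
  have "hs ! i \<le> hs ! (length hs - 1)"
    using sorted_wrt_nth_less[OF hs(2), of i "length hs - 1"] i
    by (cases "i = length hs - 1") (auto intro!: less_imp_le)
  then show "h \<le> d + length hs + 1" using hs i last_hole by (simp add: last_conv_nth)
qed

lemma infinite_nonholes: "infinite ({n. 1 \<le> n} - set hs)"
  using infinite_Ici[of "1::nat"] by (simp add: atLeast_def)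

lemma nonhole_mem: "1 \<le> nonhole hs j" "nonhole hs j \<notin> set hs"
  using enumerate_in_set[OF infinite_nonholes, of j] by (auto simp: nonhole_def)

lemma strict_mono_nonhole: "strict_mono (nonhole hs)"
  using strict_mono_enumerate[OF infinite_nonholes] by (simp add: nonhole_def[abs_def])

lemma nonhole_Suc:
  "nonhole hs (Suc j) = (LEAST n. n \<in> {n. 1 \<le> n} - set hs \<and> nonhole hs j < n)"
  unfolding nonhole_def by (rule enumerate_Suc'') (rule infinite_nonholes)

text \<open>Spacing prevents two neighbouring integers from both being holes.\<close>

lemma nonhole_Suc_eq:
  "nonhole hs (Suc j) = (if nonhole hs j + 1 \<in> set hs then nonhole hs j + 2 else nonhole hs j + 1)"
proof (cases "nonhole hs j + 1 \<in> set hs")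
  case True
  then have "nonhole hs j + 2 \<notin> set hs"
    using hole_spacing[of "nonhole hs j + 1" "nonhole hs j + 2"] by auto
  then have "(LEAST n. n \<in> {n. 1 \<le> n} - set hs \<and> nonhole hs j < n) = nonhole hs j + 2"
  proof (intro Least_equality)
    fix y assume y: "y \<in> {n. 1 \<le> n} - set hs \<and> nonhole hs j < y"
    then have "y \<noteq> nonhole hs j + 1" using True by auto
    then show "nonhole hs j + 2 \<le> y" using y by linarith
  qed simp
  then show ?thesis using True by (simp add: nonhole_Suc)
next
  case False
  then have "(LEAST n. n \<in> {n. 1 \<le> n} - set hs \<and> nonhole hs j < n) = nonhole hs j + 1"
    by (intro Least_equality) auto
  then show ?thesis using False by (simp add: nonhole_Suc)
qed

text \<open>Two consecutive gaps of size 2 would come from two holes at distance 2.\<close>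

lemma nonhole_double_gap:
  assumes "nonhole hs (Suc j) = nonhole hs j + 2"
  shows "nonhole hs (Suc (Suc j)) = nonhole hs (Suc j) + 1"
proof -
  have "nonhole hs j + 1 \<in> set hs" using assms by (simp add: nonhole_Suc_eq split: if_splits)
  then have "nonhole hs (Suc j) + 1 \<notin> set hs"
    using hole_spacing[of "nonhole hs j + 1" "nonhole hs j + 3"] assms by (auto simp: eval_nat_numeral)
  then show ?thesis by (simp add: nonhole_Suc_eq[of "Suc j"])
qed

lemma nonhole_init: "j < 6 \<Longrightarrow> nonhole hs j = Suc j"
proof (induction j)
  case 0
  have "(LEAST n. n \<in> {n. 1 \<le> n} - set hs) = 1"
    using hole_bounds(1)[of 1] by (intro Least_equality) auto
  then show ?case by (simp add: nonhole_def enumerate_0)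
next
  case (Suc j)
  then have "nonhole hs j + 1 \<notin> set hs" using hole_bounds(1)[of "nonhole hs j + 1"] by auto
  then show ?case using Suc by (simp add: nonhole_Suc_eq)
qed

text \<open>The interval contains all holes, so exactly \<open>d + 2\<close> of its elements remain.
  They are closed under passing to smaller nonholes, hence are the first ones enumerated.\<close>

lemma nonhole_image: "nonhole hs ` {..<d + 2} = {1..d + length hs + 2} - set hs"
proof -
  let ?T = "{1..d + length hs + 2} - set hs"
  have sub: "set hs \<subseteq> {1..d + length hs + 2}" using hole_bounds by fastforce
  have "distinct hs" using hs(2) strict_sorted_iff by blast
  then have cT: "card ?T = d + 2"
    using sub by (simp add: card_Diff_subset distinct_card)
  have inj: "inj (nonhole hs)" using strict_mono_nonhole strict_mono_imp_inj_on by blast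
  have "?T \<subseteq> nonhole hs ` {..<d + 2}"
  proof
    fix x assume x: "x \<in> ?T"
    then obtain j where j: "nonhole hs j = x"
      using enumerate_Ex[OF infinite_nonholes, of x] by (auto simp: nonhole_def)
    have "nonhole hs ` {..j} \<subseteq> ?T"
    proof
      fix y assume "y \<in> nonhole hs ` {..j}"
      then obtain i where "i \<le> j" "y = nonhole hs i" by auto
      moreover from this have "y \<le> x"
        using j strict_mono_less_eq[OF strict_mono_nonhole, of i j] by simp
      ultimately show "y \<in> ?T" using x nonhole_mem[of i] by auto
    qed
    then have "card (nonhole hs ` {..j}) \<le> card ?T" by (intro card_mono) auto
    then have "Suc j \<le> d + 2" using cT inj by (simp add: card_image inj_on_subset)
    then show "x \<in> nonhole hs ` {..<d + 2}" using j by auto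
  qed
  then have "?T = nonhole hs ` {..<d + 2}"
    using cT inj by (intro card_subset_eq) (auto simp: card_image inj_on_subset)
  then show ?thesis by simp
qed

lemma last_hole_mem: "d + length hs + 1 \<in> set hs"
  using hs(1) last_hole last_in_set by metis

lemma nonhole_le: "j < d + 2 \<Longrightarrow> nonhole hs j \<le> d + length hs + 2"
  using nonhole_image by auto

lemma nonhole_last: "nonhole hs (d + 1) = d + length hs + 2"
proof -
  have "d + length hs + 2 \<in> nonhole hs ` {..<d + 2}"
    using nonhole_image hole_bounds(2)[of "d + length hs + 2"] by auto
  then obtain j where "j < d + 2" "nonhole hs j = d + length hs + 2" by auto
  then have "d + length hs + 2 \<le> nonhole hs (d + 1)"
    using strict_mono_less_eq[OF strict_mono_nonhole, of j "d + 1"] by simp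
  then show ?thesis using nonhole_le[of "d + 1"] by simp
qed

text \<open>The last hole lies directly below the largest coefficient.\<close>

lemma nonhole_last_gap: "nonhole hs (d + 1) = nonhole hs d + 2"
proof (rule ccontr)
  assume "\<not> ?thesis"
  then have "nonhole hs d = d + length hs + 1"
    using nonhole_Suc_eq[of d] nonhole_last by (simp split: if_splits)
  then show False using last_hole_mem nonhole_mem(2)[of d] by simp
qed

text \<open>Slope \<open>-1\<close> would match \<open>1, 2\<close> for \<open>hs'\<close> with the maximum for \<open>hs\<close> and the number just below it,
  which is a hole.\<close>

lemma isometric_same_holes:
  assumes H': "spaced_holes d hs'"
    and isom: "lattice_isometric (d + 2) (Ld d hs) (Ld d hs')"
  shows "set hs = set hs' \<and> length hs = length hs'"
proof -
  interpret H': spaced_holes d hs' by (rule H')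
  let ?s = "nonhole hs" and ?s' = "nonhole hs'" and ?N = "d + length hs + 2"
  obtain f where f: "bij_betw f (lat (d + 2) ?s) (lat (d + 2) ?s')"
    "\<forall>x\<in>lat (d + 2) ?s. \<forall>y\<in>lat (d + 2) ?s. f (\<lambda>i. x i + y i) = (\<lambda>i. f x i + f y i)"
    "\<forall>x\<in>lat (d + 2) ?s. \<forall>y\<in>lat (d + 2) ?s. std_inner (d + 2) (f x) (f y) = std_inner (d + 2) x y"
    using isom unfolding lattice_isometric_def Ld_eq_lat by blast
  have gap: "?s (Suc j) = ?s j + 1 \<or> ?s (Suc j) = ?s j + 2" for j
    by (simp add: nonhole_Suc_eq)
  obtain \<sigma> a C where \<sigma>: "bij_betw \<sigma> {..<d + 2} {..<d + 2}"
    and aff: "\<And>j. j < d + 2 \<Longrightarrow> int (?s' (\<sigma> j)) = C + a * int (?s j)"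
  proof (rule isometry_affine[of "d + 2" ?s f ?s', OF _ gap nonhole_double_gap nonhole_init])
    show "48 \<le> d + 2" using d by simp
    show "?s (d + 2 - 1) = ?s (d + 2 - 2) + 2" using nonhole_last_gap by simp
    show "f x \<in> lat (d + 2) ?s'" if "x \<in> lat (d + 2) ?s" for x
      using f(1) that by (auto simp: bij_betw_def)
  qed (use f in blast)+
  have "\<sigma> ` {..<d + 2} = {..<d + 2}" using \<sigma> by (simp add: bij_betw_def)
  \<comment> \<open>The coefficients 1 and 2 both occur for \<open>hs'\<close>, so the slope divides
    their difference 1.\<close>
  then have "0 \<in> \<sigma> ` {..<d + 2}" "1 \<in> \<sigma> ` {..<d + 2}" by auto
  then obtain j0 j1 where j: "j0 < d + 2" "\<sigma> j0 = 0" "j1 < d + 2" "\<sigma> j1 = 1" by auto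
  have e0: "1 = C + a * int (?s j0)" and e1: "2 = C + a * int (?s j1)"
    using aff[OF j(1)] aff[OF j(3)] j H'.nonhole_init[of 0] H'.nonhole_init[of 1] by simp_all
  then have "a * (int (?s j1) - int (?s j0)) = 1" by (simp add: algebra_simps)
  then have a: "a = 1 \<or> a = -1" by (auto simp: zmult_eq_1_iff)
  have pos: "1 \<le> int (?s' (\<sigma> i))" for i using H'.nonhole_mem(1)[of "\<sigma> i"] by simp
  have "a \<noteq> -1"
  proof
    assume "a = -1"
    then have "C - int ?N \<ge> 1" "int (?s j0) = C - 1" "int (?s j1) = C - 2"
      using e0 e1 pos[of "d + 1"] aff[of "d + 1"] nonhole_last by simp_all
    then have "?s j1 = d + length hs + 1" using nonhole_le[OF j(1)] by linarith
    then show False using last_hole_mem nonhole_mem(2)[of j1] by simp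
  qed
  with a have a1: "a = 1" by simp
  \<comment> \<open>Both families have least element 1: the preimage of 1 gives
    \<open>C \<le> 0\<close>, and the image of 1 gives \<open>C \<ge> 0\<close>.\<close>
  have "C = 0" using e0 a1 nonhole_mem(1)[of j0] pos[of 0] aff[of 0] nonhole_init[of 0] by simp
  then have eq: "?s' (\<sigma> j) = ?s j" if "j < d + 2" for j using aff[OF that] a1 by simp
  have "?s' ` {..<d + 2} = ?s' ` \<sigma> ` {..<d + 2}" using \<sigma> by (simp add: bij_betw_def)
  also have "\<dots> = ?s ` {..<d + 2}" using eq by (auto simp: image_image)
  finally have img: "{1..d + length hs' + 2} - set hs' = {1..?N} - set hs"
    using nonhole_image H'.nonhole_image by simp
  \<comment> \<open>Each interval ends in a nonhole, so equal sets of nonholes have equal endpoints,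
    which gives the lengths. Complements then give the holes.\<close>
  have "?N \<in> {1..?N} - set hs" "d + length hs' + 2 \<in> {1..d + length hs' + 2} - set hs'"
    using hole_bounds(2) H'.hole_bounds(2) by fastforce+
  then have "?N \<in> {1..d + length hs' + 2}" "d + length hs' + 2 \<in> {1..?N}" using img by blast+
  then have len: "length hs = length hs'" by simp
  have "set hs = {1..?N} - ({1..?N} - set hs)" using hole_bounds by fastforce
  also have "\<dots> = {1..d + length hs' + 2} - ({1..d + length hs' + 2} - set hs')"
    unfolding img len by simp
  also have "\<dots> = set hs'" using H'.hole_bounds by fastforce
  finally show ?thesis using len by simp
qed

end

theorem theorem3p2:
  fixes d :: nat and hs hs' :: "nat list"
  assumes "d \<ge> 46"
    and "hs \<noteq> []" and "hs' \<noteq> []"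
    and "sorted_wrt (<) hs" and "sorted_wrt (<) hs'"
    and "\<forall>h\<in>set hs. h \<ge> 1" and "\<forall>h\<in>set hs'. h \<ge> 1"
    and "hd hs \<ge> 7" and "hd hs' \<ge> 7"
    and "last hs = d + length hs + 1" and "last hs' = d + length hs' + 1"
    and "\<forall>i. i + 1 < length hs \<longrightarrow> hs ! i + 4 \<le> hs ! (i + 1)"
    and "\<forall>i. i + 1 < length hs' \<longrightarrow> hs' ! i + 4 \<le> hs' ! (i + 1)"
  shows "lattice_isometric (d + 2) (Ld d hs) (Ld d hs') \<longleftrightarrow>
           (length hs = length hs' \<and> (\<forall>i < length hs. hs ! i = hs' ! i))"
proof
  interpret H: spaced_holes d hs using assms by unfold_locales auto
  interpret H': spaced_holes d hs' using assms by unfold_locales auto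
  {
    assume "lattice_isometric (d + 2) (Ld d hs) (Ld d hs')"
    then have "set hs = set hs'"
      using H.isometric_same_holes[OF H'.spaced_holes_axioms] by auto
    then have "hs = hs'" using assms(4,5) by (intro strict_sorted_equal) auto
    then show "length hs = length hs' \<and> (\<forall>i<length hs. hs ! i = hs' ! i)" by simp
  }
  assume "length hs = length hs' \<and> (\<forall>i<length hs. hs ! i = hs' ! i)"
  then have "hs = hs'" by (simp add: nth_equalityI)
  then show "lattice_isometric (d + 2) (Ld d hs) (Ld d hs')"
    unfolding lattice_isometric_def by (intro exI[of _ id]) simp
qed

end
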